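(* Let $h:\mathbb{R}\to\mathbb{R}^+$ be a growth rate. The normed vector space $\mathbb{R}_*=(\mathbb{R},*_h,\odot,|\cdot|_* )$ induced by $h$ is a Banach space; that is, every Cauchy sequence in $\mathbb{R}_*$ converges in $\mathbb{R}_*$.
   Context: A growth rate is a strictly increasing homeomorphism $h:\mathbb{R}\to\mathbb{R}^+=(0,\infty)$. It induces on $\mathbb{R}$ the operations $t*_h s:=h^{-1}(h(t)h(s))$ and, for $\alpha\in\mathbb{R}$, $\alpha\odot t:=h^{-1}(h(t)^{\alpha})$. With these, $\mathbb{R}$ is a real vector space with zero vector $e_*:=h^{-1}(1)$ and additive inverse $t^{*-1}:=h^{-1}(1/h(t))$. Set $|t|_*=t$ if $t\ge e_*$ and $|t|_*=t^{*-1}$ if $t<e_*$; this is a norm with values in $[e_*,+\infty)$ (where $e_*$ plays the role of $0$, $*_h$ the role of addition, and $\odot$ the role of scalar multiplication). A sequence $\{x_n\}\subset\mathbb{R}_*$ converges to $x$ if for every $\varepsilon>e_*$ there is $N\in\mathbb{N}$ such that $n>N$ implies $|x_n*_h x^{*-1}|_*<\varepsilon$. It is a Cauchy sequence if for every $\varepsilon>e_*$ there is $N\in\mathbb{N}$ such that $n,m>N$ implies $|x_n*_h x_m^{*-1}|_*<\varepsilon$. *)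

theory Defs
  imports "HOL-Analysis.Analysis" "HOL-Algebra.Module"
begin

definition growth_rate :: "(real \<Rightarrow> real) \<Rightarrow> bool" where
  "growth_rate h \<longleftrightarrow> strict_mono h \<and> (\<exists>g. homeomorphism UNIV {0<..} h g)"

(* A growth rate is not onto the type real, so "inv_into UNIV h" inverts h at positive
   arguments only, and below it is applied only to those when h is a growth rate. *)

definition star_add :: "(real \<Rightarrow> real) \<Rightarrow> real \<Rightarrow> real \<Rightarrow> real" where
  "star_add h t s = inv_into UNIV h (h t * h s)"

definition star_scale :: "(real \<Rightarrow> real) \<Rightarrow> real \<Rightarrow> real \<Rightarrow> real" where
  "star_scale h \<alpha> t = inv_into UNIV h (h t powr \<alpha>)"

definition star_zero :: "(real \<Rightarrow> real) \<Rightarrow> real" where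
  "star_zero h = inv_into UNIV h 1"

definition star_inverse :: "(real \<Rightarrow> real) \<Rightarrow> real \<Rightarrow> real" where
  "star_inverse h t = inv_into UNIV h (1 / h t)"

definition star_norm :: "(real \<Rightarrow> real) \<Rightarrow> real \<Rightarrow> real" where
  "star_norm h t = (if star_zero h \<le> t then t else star_inverse h t)"

definition real_scalars :: "real ring" where
  "real_scalars = \<lparr>carrier = UNIV, mult = (*), one = 1, zero = 0, add = (+)\<rparr>"

(* The library's module record extends the ring record.  The locale "module" only uses the
   additive part and the scalar multiplication, so the fields mult and one are irrelevant. *)
definition star_space :: "(real \<Rightarrow> real) \<Rightarrow> (real, real) module" where
  "star_space h = \<lparr>carrier = UNIV, mult = undefined, one = undefined,
     zero = star_zero h, add = star_add h, smult = star_scale h\<rparr>"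

(* The norm takes values in {star_zero h..}, where star_zero h, star_add h and star_scale h
   take the places of 0, addition and scalar multiplication in the norm axioms.
   The module is a vector space because real_scalars is the field of real numbers. *)
definition star_normed_vector_space :: "(real \<Rightarrow> real) \<Rightarrow> bool" where
  "star_normed_vector_space h \<longleftrightarrow>
     Module.module real_scalars (star_space h) \<and>
     (\<forall>t. star_inverse h t = \<ominus>\<^bsub>star_space h\<^esub> t) \<and>
     (\<forall>t. star_zero h \<le> star_norm h t) \<and>
     (\<forall>t. star_norm h t = star_zero h \<longleftrightarrow> t = star_zero h) \<and>
     (\<forall>\<alpha> t. star_norm h (star_scale h \<alpha> t) = star_scale h \<bar>\<alpha>\<bar> (star_norm h t)) \<and>
     (\<forall>t s. star_norm h (star_add h t s) \<le> star_add h (star_norm h t) (star_norm h s))"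

definition star_converges_to :: "(real \<Rightarrow> real) \<Rightarrow> (nat \<Rightarrow> real) \<Rightarrow> real \<Rightarrow> bool" where
  "star_converges_to h x l \<longleftrightarrow>
     (\<forall>\<epsilon>. \<epsilon> > star_zero h \<longrightarrow>
        (\<exists>N. \<forall>n>N. star_norm h (star_add h (x n) (star_inverse h l)) < \<epsilon>))"

definition star_Cauchy :: "(real \<Rightarrow> real) \<Rightarrow> (nat \<Rightarrow> real) \<Rightarrow> bool" where
  "star_Cauchy h x \<longleftrightarrow>
     (\<forall>\<epsilon>. \<epsilon> > star_zero h \<longrightarrow>
        (\<exists>N. \<forall>n>N. \<forall>m>N. star_norm h (star_add h (x n) (star_inverse h (x m))) < \<epsilon>))"

end

theory Submission
  imports Defs
begin

text \<open>The map \<open>t \<mapsto> ln (h t)\<close> is an increasing bijection of the reals that carries \<open>*\<^sub>h\<close>,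
  \<open>\<odot>\<close>, the inverse and \<open>\<bar>\<cdot>\<bar>\<^sub>*\<close> to addition, multiplication, negation and the absolute
  value. The norm axioms and completeness are therefore those of the real line.\<close>

lemma cring_real_scalars: "cring real_scalars"
proof (rule cringI)
  show "abelian_group real_scalars"
    by (rule abelian_groupI) (auto simp: real_scalars_def intro: add.left_inverse)
  show "comm_monoid real_scalars"
    by (rule comm_monoidI) (auto simp: real_scalars_def)
qed (auto simp: real_scalars_def algebra_simps)

context
  fixes h :: "real \<Rightarrow> real"
  assumes growth_rate: "growth_rate h"
begin

lemma growth_rate_pos: "0 < h t"
  using growth_rate by (auto simp: growth_rate_def homeomorphism_def)

text \<open>The range of \<open>h\<close> is all of \<open>{0<..}\<close>. Products, powers and
  reciprocals of values of \<open>h\<close> stay there, so this cancels \<open>inv_into\<close> in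
  every operation.\<close>

lemma growth_rate_inv:
  assumes "0 < y"
  shows "h (inv_into UNIV h y) = y"
proof (rule f_inv_into_f)
  show "y \<in> range h"
    using growth_rate assms by (auto simp: growth_rate_def homeomorphism_def)
qed

lemma ln_growth_rate_star_zero: "ln (h (star_zero h)) = 0"
  by (simp add: star_zero_def growth_rate_inv)

lemma ln_growth_rate_star_add: "ln (h (star_add h t s)) = ln (h t) + ln (h s)"
  by (simp add: star_add_def growth_rate_inv growth_rate_pos ln_mult_pos)

lemma ln_growth_rate_star_scale: "ln (h (star_scale h \<alpha> t)) = \<alpha> * ln (h t)"
  using growth_rate_pos[of t] by (simp add: star_scale_def growth_rate_inv ln_powr)

lemma ln_growth_rate_star_inverse: "ln (h (star_inverse h t)) = - ln (h t)"
  by (simp add: star_inverse_def growth_rate_inv growth_rate_pos ln_div)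

lemma ln_growth_rate_le_iff: "t \<le> s \<longleftrightarrow> ln (h t) \<le> ln (h s)"
  using growth_rate by (simp add: growth_rate_def strict_mono_less_eq growth_rate_pos)

lemma ln_growth_rate_less_iff: "t < s \<longleftrightarrow> ln (h t) < ln (h s)"
  using ln_growth_rate_le_iff[of s t] by linarith

lemma ln_growth_rate_eq_iff: "t = s \<longleftrightarrow> ln (h t) = ln (h s)"
  using ln_growth_rate_le_iff[of s t] ln_growth_rate_le_iff[of t s] by linarith

text \<open>Since \<open>star_zero h\<close> has logarithm 0, the case split in
  \<open>star_norm\<close> is on the sign of \<open>ln (h t)\<close>.\<close>

lemma ln_growth_rate_star_norm: "ln (h (star_norm h t)) = \<bar>ln (h t)\<bar>"
  using ln_growth_rate_le_iff[of "star_zero h" t]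
  by (simp add: star_norm_def ln_growth_rate_star_zero ln_growth_rate_star_inverse)

text \<open>Pulls back positive tolerances and real limits to points of the star space.\<close>

lemma surj_ln_growth_rate: "\<exists>t. ln (h t) = y"
  by (rule exI[of _ "inv_into UNIV h (exp y)"]) (simp add: growth_rate_inv)

lemmas ln_growth_rate_simps = ln_growth_rate_star_zero ln_growth_rate_star_add
  ln_growth_rate_star_scale ln_growth_rate_star_inverse ln_growth_rate_star_norm

text \<open>The unrestricted equivalences would loop as rewrite rules, because their right-hand
  sides compare real numbers again.\<close>

lemmas star_eq_iffs =
  ln_growth_rate_eq_iff[of "star_add h t s" for t s]
  ln_growth_rate_eq_iff[of "star_scale h \<alpha> t" for \<alpha> t]
  ln_growth_rate_eq_iff[of "star_norm h t" for t]
  ln_growth_rate_eq_iff[of _ "star_zero h"]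

lemmas star_le_iffs =
  ln_growth_rate_le_iff[of "star_zero h"]
  ln_growth_rate_le_iff[of "star_norm h t" for t]

text \<open>By injectivity of \<open>ln\<close> after \<open>h\<close>, each axiom on points reduces
  to an identity between real numbers.\<close>

lemma module_star_space: "Module.module real_scalars (star_space h)"
proof (rule moduleI)
  show "cring real_scalars"
    by (rule cring_real_scalars)
  show "abelian_group (star_space h)"
  proof (rule abelian_groupI)
    show "\<exists>s\<in>carrier (star_space h). s \<oplus>\<^bsub>star_space h\<^esub> t = \<zero>\<^bsub>star_space h\<^esub>" for t
      by (rule bexI[of _ "star_inverse h t"])
        (simp_all add: star_space_def star_eq_iffs ln_growth_rate_simps)
  qed (simp_all add: star_space_def star_eq_iffs ln_growth_rate_simps)
qed (simp_all add: star_space_def real_scalars_def star_eq_iffs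
    ln_growth_rate_simps algebra_simps)

lemma star_inverse_eq_a_inv: "star_inverse h t = \<ominus>\<^bsub>star_space h\<^esub> t"
proof -
  interpret Module.module real_scalars "star_space h"
    by (rule module_star_space)
  have "\<ominus>\<^bsub>star_space h\<^esub> t = star_inverse h t"
    \<comment> \<open>Additive inverses in a group are unique.\<close>
    by (rule M.minus_equality)
      (simp_all add: star_space_def star_eq_iffs ln_growth_rate_simps)
  then show ?thesis ..
qed

lemma star_normed_vector_space: "star_normed_vector_space h"
  unfolding star_normed_vector_space_def
  by (auto simp: module_star_space star_inverse_eq_a_inv[symmetric] star_le_iffs
      star_eq_iffs ln_growth_rate_simps abs_mult)

text \<open>By monotonicity and surjectivity, \<open>ln (h \<epsilon>)\<close> runs through exactly
  the positive reals as \<open>\<epsilon>\<close> runs through the points above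
  \<open>star_zero h\<close>.\<close>

lemma all_greater_star_zero_iff:
  "(\<forall>\<epsilon>>star_zero h. P (ln (h \<epsilon>))) \<longleftrightarrow> (\<forall>\<epsilon>>0. P \<epsilon>)"
proof -
  have "(\<forall>\<epsilon>>0. P \<epsilon>) \<longleftrightarrow> (\<forall>t. 0 < ln (h t) \<longrightarrow> P (ln (h t)))"
    using surj_ln_growth_rate by metis
  then show ?thesis
    by (simp only: ln_growth_rate_less_iff[of "star_zero h"] ln_growth_rate_star_zero)
qed

lemma star_converges_to_iff_LIMSEQ:
  "star_converges_to h x l \<longleftrightarrow> (\<lambda>n. ln (h (x n))) \<longlonglongrightarrow> ln (h l)"
proof -
  have "star_converges_to h x l \<longleftrightarrow>
      (\<forall>\<epsilon>>0. \<exists>N. \<forall>n>N. \<bar>ln (h (x n)) - ln (h l)\<bar> < \<epsilon>)"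
    \<comment> \<open>Only comparisons with a norm on the left pass to logarithms, so the guard on
      \<open>\<epsilon>\<close> survives; the right-hand side is then rewritten to the same
      guard.\<close>
    unfolding star_converges_to_def ln_growth_rate_less_iff[of "star_norm h t" for t]
      all_greater_star_zero_iff[of "\<lambda>\<epsilon>. \<exists>N. \<forall>n>N. \<bar>ln (h (x n)) - ln (h l)\<bar> < \<epsilon>", symmetric]
    by (simp add: ln_growth_rate_simps)
  also have "\<dots> \<longleftrightarrow> (\<lambda>n. ln (h (x n))) \<longlonglongrightarrow> ln (h l)"
    \<comment> \<open>The library asks for \<open>n \<ge> N\<close> instead of \<open>n > N\<close>;
      \<open>Suc N\<close> bridges the two.\<close>
    unfolding LIMSEQ_iff real_norm_def by (meson Suc_le_eq less_imp_le_nat)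
  finally show ?thesis .
qed

lemma star_Cauchy_iff_Cauchy: "star_Cauchy h x \<longleftrightarrow> Cauchy (\<lambda>n. ln (h (x n)))"
proof -
  have "star_Cauchy h x \<longleftrightarrow>
      (\<forall>\<epsilon>>0. \<exists>N. \<forall>n>N. \<forall>m>N. \<bar>ln (h (x n)) - ln (h (x m))\<bar> < \<epsilon>)"
    unfolding star_Cauchy_def ln_growth_rate_less_iff[of "star_norm h t" for t]
      all_greater_star_zero_iff
        [of "\<lambda>\<epsilon>. \<exists>N. \<forall>n>N. \<forall>m>N. \<bar>ln (h (x n)) - ln (h (x m))\<bar> < \<epsilon>", symmetric]
    by (simp add: ln_growth_rate_simps)
  also have "\<dots> \<longleftrightarrow> Cauchy (\<lambda>n. ln (h (x n)))"
    unfolding Cauchy_iff real_norm_def by (meson Suc_le_eq less_imp_le_nat)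
  finally show ?thesis .
qed

end

theorem lemma8:
  fixes h :: "real \<Rightarrow> real"
  assumes "growth_rate h"
  shows "star_normed_vector_space h \<and>
    (\<forall>x. star_Cauchy h x \<longrightarrow> (\<exists>l. star_converges_to h x l))"
proof (intro conjI allI impI)
  show "star_normed_vector_space h"
    using assms by (rule star_normed_vector_space)
  fix x assume "star_Cauchy h x"
  \<comment> \<open>Completeness of the real line enters here.\<close>
  then obtain L where "(\<lambda>n. ln (h (x n))) \<longlonglongrightarrow> L"
    using star_Cauchy_iff_Cauchy[OF assms] Cauchy_convergent_iff convergent_def by metis
  moreover obtain l where "ln (h l) = L"
    using surj_ln_growth_rate[OF assms] by blast
  ultimately show "\<exists>l. star_converges_to h x l"
    using star_converges_to_iff_LIMSEQ[OF assms] by blast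
qed

end
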